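(* Let $A$ be an affine space of any dimension over a field $K$ of characteristic $\neq 2$, let $\ell$ be a line in $A$, let $M$ be a point on $\ell$, and let a pencil of quadrics in $A$ be given. Suppose that at least one of the following two conditions holds: (1) a quadric in the pencil is tangent to $\ell$ at $M$, and another quadric in the pencil intersects $\ell$ (either over $K$ or over an algebraic closure of $K$) in two distinct points $P$ and $Q$ symmetric about $M$ (i.e., $M$ is the midpoint of $P$ and $Q$); or (2) two different quadrics in the pencil intersect $\ell$ (either over $K$ or over an algebraic closure of $K$) in two different pairs of distinct points, each pair of which is symmetric about $M$. Then for every quadric in the pencil one of the following holds: (i) the line $\ell$ is either tangent to the quadric at $M$ or an asymptote of the quadric (meaning that $\ell$ intersects and is tangent to the quadric at infinity); or (ii) the line $\ell$ intersects the quadric in two actual points (over $K$) or two virtual points (over an algebraic closure of $K$) that are symmetric about $M$.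
   Context: The affine space $A$ is regarded as the complement of a hyperplane (the hyperplane at infinity) in a projective space $P(V)$ of the same dimension, where $V$ is a $K$-vector space and $P(V)$ is the set of lines through the origin in $V$. The affine line $\ell$ is extended to a projective line $P(E) = \ell \cup \{N\}$, where $E \subseteq V$ has linear dimension $2$ and $N$ is a point of the hyperplane at infinity (the point at infinity of $\ell$). A quadric is given by a non-zero symmetric bilinear form $q$ on $V$ (up to a non-zero scalar); its points are those represented by non-zero vectors $v$ with $q(v,v)=0$, and quadrics in $A$ are considered together with their points at infinity in $P(V)$. A pencil of quadrics is a linear system of projective dimension $1$: the family of quadrics given by the forms $aR+bS$, $(a,b) \in K^2 \setminus \{(0,0)\}$, with $R,S$ two fixed linearly independent symmetric bilinear forms on $V$. The projective line $P(E)$ is tangent to the quadric of $q$ at a point $T \in P(E)$ if the restriction $q|_E$ is non-zero and degenerate with radical equal to the one-dimensional subspace $T$ (so $T$ is the only intersection point of $P(E)$ with the quadric). $\ell$ is an asymptote of the quadric if $P(E)$ is tangent to the quadric at $N$. Intersection points over an algebraic closure $L$ of $K$ are points of $P(E \otimes_K L)$ that are zeros of the form extended to $L$; two points of the affine line $\ell$ (over $K$ or over $L$) are symmetric about $M$ if $M$ is their midpoint, i.e., their coordinates are $x$ and $-x$ in an affine coordinate on $\ell$ with origin $M$. *)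

theory Defs
  imports "HOL-Algebra.Algebraic_Closure_Type" "HOL-Library.Function_Algebras"
begin

section \<open>Projective and affine geometry in a vector space\<close>

type_synonym ('k, 'v) scaling = "'k \<Rightarrow> 'v \<Rightarrow> 'v"

definition proj_space :: "('k::field, 'v::ab_group_add) scaling \<Rightarrow> 'v set \<Rightarrow> 'v set set" where
  "proj_space s U = {module.span s {v} | v. v \<in> U \<and> v \<noteq> 0}"

definition hyperplane :: "('k::field, 'v::ab_group_add) scaling \<Rightarrow> 'v set \<Rightarrow> bool" where
  "hyperplane s H \<longleftrightarrow>
     module.subspace s H \<and> H \<noteq> UNIV \<and> (\<exists>v. module.span s (insert v H) = UNIV)"

text \<open>The affine space with hyperplane at infinity \<open>H\<close> is \<open>affine_part s H UNIV\<close>; the affine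
  line whose projective closure is \<open>proj_space s E\<close> is \<open>affine_part s H E\<close>, and its point at
  infinity is the one-dimensional subspace \<open>E \<inter> H\<close>.\<close>

definition affine_part ::
  "('k::field, 'v::ab_group_add) scaling \<Rightarrow> 'v set \<Rightarrow> 'v set \<Rightarrow> 'v set set" where
  "affine_part s H U = proj_space s U - proj_space s H"

definition is_affine_line ::
  "('k::field, 'v::ab_group_add) scaling \<Rightarrow> 'v set \<Rightarrow> 'v set \<Rightarrow> bool" where
  "is_affine_line s H E \<longleftrightarrow>
     module.subspace s E \<and> vector_space.dim s E = 2 \<and> \<not> E \<subseteq> H"

text \<open>For \<open>m \<in> E - H\<close> and a direction vector \<open>d \<in> E \<inter> H\<close>, \<open>d \<noteq> 0\<close>, the map
  \<open>x \<mapsto> coord_point s m d x\<close> is the inverse of an affine coordinate on the affine line,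
  with origin the point spanned by \<open>m\<close>.\<close>

definition coord_point ::
  "('k::field, 'v::ab_group_add) scaling \<Rightarrow> 'v \<Rightarrow> 'v \<Rightarrow> 'k \<Rightarrow> 'v set" where
  "coord_point s m d x = module.span s {m + s x d}"

definition symmetric_about ::
  "('k::field, 'v::ab_group_add) scaling \<Rightarrow> 'v set \<Rightarrow> 'v set \<Rightarrow> 'v set \<Rightarrow> 'v set \<Rightarrow> 'v set \<Rightarrow> bool"
  where
  "symmetric_about s H E M P Q \<longleftrightarrow>
     (\<exists>m d x. m \<in> E - H \<and> d \<in> E \<inter> H \<and> d \<noteq> 0 \<and> M = module.span s {m} \<and>
              P = coord_point s m d x \<and> Q = coord_point s m d (- x))"

definition sym_bilinear ::
  "('k::field, 'v::ab_group_add) scaling \<Rightarrow> ('v \<Rightarrow> 'v \<Rightarrow> 'k) \<Rightarrow> bool" where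
  "sym_bilinear s q \<longleftrightarrow>
     (\<forall>u v. q u v = q v u) \<and> (\<forall>v. Vector_Spaces.linear s (*) (\<lambda>u. q u v))"

definition quadric ::
  "('k::field, 'v::ab_group_add) scaling \<Rightarrow> ('v \<Rightarrow> 'v \<Rightarrow> 'k) \<Rightarrow> 'v set set" where
  "quadric s q = {module.span s {v} | v. v \<noteq> 0 \<and> q v v = 0}"

definition radical_on :: "'v set \<Rightarrow> ('v \<Rightarrow> 'v \<Rightarrow> 'k::field) \<Rightarrow> 'v set" where
  "radical_on E q = {u \<in> E. \<forall>v\<in>E. q u v = 0}"

definition tangent_at ::
  "('k::field, 'v::ab_group_add) scaling \<Rightarrow> 'v set \<Rightarrow> 'v set \<Rightarrow> ('v \<Rightarrow> 'v \<Rightarrow> 'k) \<Rightarrow> bool" where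
  "tangent_at s E T q \<longleftrightarrow>
     T \<in> proj_space s E \<and> (\<exists>u\<in>E. \<exists>v\<in>E. q u v \<noteq> 0) \<and> radical_on E q = T"

definition asymptote ::
  "('k::field, 'v::ab_group_add) scaling \<Rightarrow> 'v set \<Rightarrow> 'v set \<Rightarrow> ('v \<Rightarrow> 'v \<Rightarrow> 'k) \<Rightarrow> bool" where
  "asymptote s H E q \<longleftrightarrow> tangent_at s E (E \<inter> H) q"

definition meets_in_symmetric_points ::
  "('k::field, 'v::ab_group_add) scaling \<Rightarrow> 'v set \<Rightarrow> 'v set \<Rightarrow> 'v set \<Rightarrow>
   ('v \<Rightarrow> 'v \<Rightarrow> 'k) \<Rightarrow> 'v set \<Rightarrow> 'v set \<Rightarrow> bool" where
  "meets_in_symmetric_points s H E M q P Q \<longleftrightarrow>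
     P \<noteq> Q \<and> proj_space s E \<inter> quadric s q = {P, Q} \<and> symmetric_about s H E M P Q"

section \<open>Pencils\<close>

text \<open>A quadric is a non-zero symmetric bilinear form up to a non-zero scalar, so two forms
  define different quadrics iff \<open>same_quadric\<close> fails.\<close>

definition same_quadric :: "('v \<Rightarrow> 'v \<Rightarrow> 'k::field) \<Rightarrow> ('v \<Rightarrow> 'v \<Rightarrow> 'k) \<Rightarrow> bool" where
  "same_quadric F G \<longleftrightarrow> (\<exists>c. c \<noteq> 0 \<and> F = (\<lambda>u v. c * G u v))"

definition lin_indep_forms :: "('v \<Rightarrow> 'v \<Rightarrow> 'k::field) \<Rightarrow> ('v \<Rightarrow> 'v \<Rightarrow> 'k) \<Rightarrow> bool" where
  "lin_indep_forms R S \<longleftrightarrow> (\<forall>a b. (\<forall>u v. a * R u v + b * S u v = 0) \<longrightarrow> a = 0 \<and> b = 0)"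

definition pencil ::
  "('v \<Rightarrow> 'v \<Rightarrow> 'k::field) \<Rightarrow> ('v \<Rightarrow> 'v \<Rightarrow> 'k) \<Rightarrow> ('v \<Rightarrow> 'v \<Rightarrow> 'k) set" where
  "pencil R S = {(\<lambda>u v. a * R u v + b * S u v) | a b. (a, b) \<noteq> (0, 0)}"

section \<open>Extension of scalars to the algebraic closure\<close>

text \<open>\<open>scalar_extension s t \<iota>\<close>: the \<open>K\<close>-linear map \<open>\<iota>\<close> from the \<open>K\<close>-space \<open>V\<close> to the
  \<open>L\<close>-space \<open>W\<close> sends \<open>K\<close>-independent vectors to \<open>L\<close>-independent vectors.  Equivalently, the
  induced \<open>L\<close>-linear map from the tensor product of \<open>V\<close> and \<open>L\<close> over \<open>K\<close> to \<open>W\<close> is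
  injective, so the \<open>L\<close>-span of the image under \<open>\<iota>\<close> of a subspace \<open>U\<close> of \<open>V\<close> is a copy of the tensor
  product of \<open>U\<close> with \<open>L\<close>.  The span of \<open>range \<iota>\<close> need not be all of \<open>W\<close>, because a
  vector space that is exactly the tensor product need not be available on a given type.\<close>

definition scalar_extension ::
  "('k::field, 'v::ab_group_add) scaling \<Rightarrow> ('k alg_closure, 'w::ab_group_add) scaling \<Rightarrow>
   ('v \<Rightarrow> 'w) \<Rightarrow> bool" where
  "scalar_extension s t \<iota> \<longleftrightarrow>
     vector_space s \<and> vector_space t \<and>
     (\<forall>u v. \<iota> (u + v) = \<iota> u + \<iota> v) \<and>
     (\<forall>c v. \<iota> (s c v) = t (to_ac c) (\<iota> v)) \<and>
     (\<forall>B. \<not> module.dependent s B \<longrightarrow> inj_on \<iota> B \<and> \<not> module.dependent t (\<iota> ` B))"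

definition ext_subspace ::
  "('k::field alg_closure, 'w::ab_group_add) scaling \<Rightarrow> ('v \<Rightarrow> 'w) \<Rightarrow> 'v set \<Rightarrow> 'w set" where
  "ext_subspace t \<iota> U = module.span t (\<iota> ` U)"

text \<open>The extended form is unique on \<open>ext_subspace t \<iota> UNIV\<close>, the only place where its values
  matter; see \<open>ext_form_spec\<close> and \<open>ext_form_unique\<close> below.\<close>

definition ext_form ::
  "('k::field alg_closure, 'w::ab_group_add) scaling \<Rightarrow> ('v \<Rightarrow> 'w) \<Rightarrow>
   ('v \<Rightarrow> 'v \<Rightarrow> 'k) \<Rightarrow> ('w \<Rightarrow> 'w \<Rightarrow> 'k alg_closure)" where
  "ext_form t \<iota> q =
     (SOME Q. sym_bilinear t Q \<and> (\<forall>u v. Q (\<iota> u) (\<iota> v) = to_ac (q u v)))"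

text \<open>The pair of intersection points, over \<open>K\<close> or over \<open>L\<close>, is recorded as a set \<open>Z\<close> of points
  over \<open>L\<close>, so that pairs over \<open>K\<close> and pairs over \<open>L\<close> can be compared.\<close>

definition meets_in_symmetric_pair ::
  "('k::field, 'v::ab_group_add) scaling \<Rightarrow> ('k alg_closure, 'w::ab_group_add) scaling \<Rightarrow>
   ('v \<Rightarrow> 'w) \<Rightarrow> 'v set \<Rightarrow> 'v set \<Rightarrow> 'v set \<Rightarrow> ('v \<Rightarrow> 'v \<Rightarrow> 'k) \<Rightarrow> 'w set set \<Rightarrow> bool" where
  "meets_in_symmetric_pair s t \<iota> H E M q Z \<longleftrightarrow>
     (\<exists>P Q. meets_in_symmetric_points s H E M q P Q \<and>
            Z = {ext_subspace t \<iota> P, ext_subspace t \<iota> Q}) \<or>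
     (\<exists>P Q. meets_in_symmetric_points t
              (ext_subspace t \<iota> H) (ext_subspace t \<iota> E) (ext_subspace t \<iota> M)
              (ext_form t \<iota> q) P Q \<and>
            Z = {P, Q})"

subsection \<open>Existence of scalar extensions and of extended forms\<close>

lemma scalar_extension_exists:
  fixes s :: "'k::field \<Rightarrow> 'v::ab_group_add \<Rightarrow> 'v"
  assumes "vector_space s"
  shows "\<exists>\<iota> :: 'v \<Rightarrow> ('v \<Rightarrow> 'k alg_closure). scalar_extension s (\<lambda>c f x. c * f x) \<iota>"
proof -
  interpret V: vector_space s by fact
  let ?t = "\<lambda>(c :: 'k alg_closure) (f :: 'v \<Rightarrow> 'k alg_closure) x. c * f x"
  interpret W: vector_space ?t
    by unfold_locales (auto simp: fun_eq_iff algebra_simps)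
  interpret VK: vector_space_pair s "(*) :: 'k \<Rightarrow> 'k \<Rightarrow> 'k"
    by unfold_locales (auto simp: algebra_simps)
  define B where "B = V.extend_basis {}"
  have B: "V.independent B" "V.span B = UNIV"
    unfolding B_def
    using V.independent_extend_basis[OF V.independent_empty] V.span_extend_basis[OF V.independent_empty]
    by blast+
  define \<iota> where "\<iota> = (\<lambda>v b. to_ac (V.representation B v b))"
  have add: "\<iota> (u + v) = \<iota> u + \<iota> v" for u v
    using B by (simp add: \<iota>_def fun_eq_iff V.representation_add)
  have scl: "\<iota> (s c v) = ?t (to_ac c) (\<iota> v)" for c v
    using B by (simp add: \<iota>_def fun_eq_iff V.representation_scale)
  have rep: "v = (\<Sum>b | V.representation B v b \<noteq> 0. s (V.representation B v b) b)" for v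
    using V.sum_nonzero_representation_eq[of B v] B by simp
  have inj: "inj \<iota>"
  proof (rule injI)
    fix u v assume "\<iota> u = \<iota> v"
    then have "V.representation B u = V.representation B v"
      by (auto simp: \<iota>_def fun_eq_iff)
    then show "u = v" using rep[of u] rep[of v] by simp
  qed
  have ind: "W.independent (\<iota> ` C)" if C: "V.independent C" for C
  proof (subst W.independent_explicit_finite_subsets, intro allI impI ballI)
    fix A u w
    assume A: "A \<subseteq> \<iota> ` C" "finite A" and eq: "(\<Sum>w\<in>A. ?t (u w) w) = 0" and w: "w \<in> A"
    define D where "D = C \<inter> \<iota> -` A"
    have AD: "A = \<iota> ` D" using A by (auto simp: D_def)
    have fD: "finite D" using A(2) unfolding AD by (rule finite_imageD) (use inj in \<open>auto simp: inj_on_def\<close>)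
    have DC: "D \<subseteq> C" by (auto simp: D_def)
    from w AD obtain v where v: "v \<in> D" "w = \<iota> v" by auto
    define \<phi> where "\<phi> = VK.construct C (\<lambda>c. if c = v then 1 else 0)"
    have lin: "Vector_Spaces.linear s (*) \<phi>" unfolding \<phi>_def by (rule VK.linear_construct[OF C])
    have val: "\<phi> c = (if c = v then 1 else 0)" if "c \<in> C" for c
      unfolding \<phi>_def using VK.construct_basis[OF C that] by simp
    define Z where "Z = (\<Union>c\<in>D. {b. V.representation B c b \<noteq> 0})"
    have fX: "finite Z" unfolding Z_def using fD by (auto simp: V.finite_representation)
    interpret phi: Vector_Spaces.linear s "(*)" \<phi> by fact
    have phi_rep: "to_ac (\<phi> c) = (\<Sum>b\<in>Z. \<iota> c b * to_ac (\<phi> b))" if "c \<in> D" for c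
    proof -
      have "\<phi> c = \<phi> (\<Sum>b | V.representation B c b \<noteq> 0. s (V.representation B c b) b)"
        using rep[of c] by simp
      also have "\<dots> = (\<Sum>b | V.representation B c b \<noteq> 0. V.representation B c b * \<phi> b)"
        by (simp add: phi.sum phi.scale)
      also have "\<dots> = (\<Sum>b\<in>Z. V.representation B c b * \<phi> b)"
        by (rule sum.mono_neutral_left[OF fX]) (use that in \<open>auto simp: Z_def\<close>)
      finally show ?thesis by (simp add: to_ac_sum \<iota>_def)
    qed
    have eq': "(\<Sum>c\<in>D. u (\<iota> c) * \<iota> c b) = 0" for b
    proof -
      have "(\<Sum>w\<in>A. ?t (u w) w) b = (\<Sum>w\<in>A. u w * w b)"
        using A(2) by (induction A rule: finite_induct) auto
      then have "(\<Sum>w\<in>A. u w * w b) = 0" using eq by simp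
      then show ?thesis unfolding AD
        by (subst (asm) sum.reindex) (use inj in \<open>auto simp: inj_on_def\<close>)
    qed
    have "u w = (\<Sum>c\<in>D. u (\<iota> c) * to_ac (\<phi> c))"
    proof -
      have "(\<Sum>c\<in>D. u (\<iota> c) * to_ac (\<phi> c)) = (\<Sum>c\<in>D. if c = v then u w else 0)"
        by (rule sum.cong) (use val DC v in auto)
      then show ?thesis using v fD by simp
    qed
    also have "\<dots> = (\<Sum>c\<in>D. \<Sum>b\<in>Z. u (\<iota> c) * \<iota> c b * to_ac (\<phi> b))"
      by (rule sum.cong) (auto simp: phi_rep sum_distrib_left mult.assoc)
    also have "\<dots> = (\<Sum>b\<in>Z. (\<Sum>c\<in>D. u (\<iota> c) * \<iota> c b) * to_ac (\<phi> b))"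
      by (subst sum.swap) (simp add: sum_distrib_right)
    also have "\<dots> = 0" by (simp add: eq')
    finally show "u w = 0" .
  qed
  have "scalar_extension s ?t \<iota>"
    unfolding scalar_extension_def
    using add scl ind inj by (auto intro: V.vector_space_axioms W.vector_space_axioms inj_on_subset)
  then show ?thesis by blast
qed

lemma ext_form_exists:
  fixes s :: "'k::field \<Rightarrow> 'v::ab_group_add \<Rightarrow> 'v"
    and t :: "'k alg_closure \<Rightarrow> 'w::ab_group_add \<Rightarrow> 'w"
  assumes ext: "scalar_extension s t \<iota>" and q: "sym_bilinear s q"
  shows "\<exists>Q. sym_bilinear t Q \<and> (\<forall>u v. Q (\<iota> u) (\<iota> v) = to_ac (q u v))"
proof -
  interpret V: vector_space s using ext by (simp add: scalar_extension_def)
  interpret p: vector_space_pair t "(*) :: 'k alg_closure \<Rightarrow> _"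
    using ext by (auto simp: scalar_extension_def vector_space_pair_def vector_space_def algebra_simps)
  have add: "\<iota> (u + v) = \<iota> u + \<iota> v" and scl: "\<iota> (s c v) = t (to_ac c) (\<iota> v)" for u v c
    using ext by (auto simp: scalar_extension_def)
  define B where "B = V.extend_basis {}"
  have B: "V.independent B" "V.span B = UNIV"
    unfolding B_def
    using V.independent_extend_basis[OF V.independent_empty] V.span_extend_basis[OF V.independent_empty]
    by blast+
  define C where "C = \<iota> ` B"
  have inj: "inj_on \<iota> B" and C: "p.vs1.independent C"
    using ext B by (auto simp: scalar_extension_def C_def)
  have qsym: "q u v = q v u" for u v using q by (simp add: sym_bilinear_def)
  have qlin: "Vector_Spaces.linear s (*) (\<lambda>u. q u v)" for v using q by (simp add: sym_bilinear_def)
  define g where "g = (\<lambda>c d. to_ac (q (inv_into B \<iota> c) (inv_into B \<iota> d)))"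
  define Q where "Q = (\<lambda>x y. p.construct C (\<lambda>c. p.construct C (\<lambda>d. g c d) y) x)"
  have lin1: "Vector_Spaces.linear t (*) (\<lambda>x. Q x y)" for y
    unfolding Q_def by (rule p.linear_construct[OF C])
  have lin2: "Vector_Spaces.linear t (*) (\<lambda>y. Q x y)" for x
  proof -
    have l: "Vector_Spaces.linear t (*) (p.construct C (\<lambda>d. g c d))" for c
      by (rule p.linear_construct[OF C])
    have a: "p.construct C (g c) (y + z) = p.construct C (g c) y + p.construct C (g c) z" for c y z
      using l[of c] by (simp add: Vector_Spaces.linear_iff)
    have m: "p.construct C (g c) (t k y) = k * p.construct C (g c) y" for c k y
      using l[of c] by (simp add: Vector_Spaces.linear_iff)
    show ?thesis
      unfolding Vector_Spaces.linear_iff Q_def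
      using p.vs1.vector_space_axioms p.vs2.vector_space_axioms
      by (simp add: a m p.construct_add[OF C] p.construct_scale[OF C])
  qed
  define D where "D = p.vs1.extend_basis C"
  have D: "p.vs1.span D = UNIV" "C \<subseteq> D"
    unfolding D_def using C by (simp_all add: p.vs1.span_extend_basis p.vs1.extend_basis_superset)
  have out: "p.construct C f d = 0" if "d \<in> D" "d \<notin> C" for d f
    using p.construct_outside[OF C p.vs1.span_base, of d] that by (auto simp: D_def)
  have zero: "p.construct C (\<lambda>c. 0) x = 0" for x
    using p.construct_scale[OF C, of 0 "\<lambda>_. 0" x] by simp
  have val: "Q c d = (if c \<in> C \<and> d \<in> C then g c d else 0)" if "c \<in> D" "d \<in> D" for c d
    using that by (auto simp: Q_def out zero p.construct_basis[OF C])
  have gsym: "g c d = g d c" for c d by (simp add: g_def qsym)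
  have sym_D: "Q x d = Q d x" if "d \<in> D" for x d
    by (rule p.linear_eq_on[OF lin1 lin2, where B = D]) (use D that in \<open>auto simp: val gsym\<close>)
  have sym: "Q x y = Q y x" for x y
    by (rule p.linear_eq_on[OF lin2 lin1, where B = D]) (use D in \<open>auto simp: sym_D\<close>)
  have QB: "Q (\<iota> b) (\<iota> c) = to_ac (q b c)" if "b \<in> B" "c \<in> B" for b c
  proof -
    have "\<iota> b \<in> C" "\<iota> c \<in> C" using that by (auto simp: C_def)
    then show ?thesis using val D inj that by (auto simp: g_def inv_into_f_f subset_iff)
  qed
  have Qadd: "Q (x + x') y = Q x y + Q x' y" and Qscl: "Q (t k x) y = k * Q x y" for x x' y k
    using lin1[of y] by (auto simp: Vector_Spaces.linear_iff)
  have qadd: "q (x + x') y = q x y + q x' y" and qscl: "q (s k x) y = k * q x y" for x x' y k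
    using qlin[of y] by (auto simp: Vector_Spaces.linear_iff)
  have step: "Q (\<iota> u) (\<iota> v) = to_ac (q u v)" if "\<And>b. b \<in> B \<Longrightarrow> Q (\<iota> b) (\<iota> v) = to_ac (q b v)" for u v
  proof -
    have "u \<in> V.span B" using B by simp
    then show ?thesis
    proof (induction rule: V.span_induct_alt)
      case base
      have "\<iota> 0 = 0" using add[of 0 0] by simp
      moreover have "q 0 v = 0" using qscl[of 0 0 v] V.scale_zero_left by simp
      moreover have "Q 0 y = 0" for y using Qscl[of 0 0 y] p.vs1.scale_zero_left by simp
      ultimately show ?case by simp
    next
      case (step c x y)
      then show ?case using that by (simp add: add scl Qadd Qscl qadd qscl)
    qed
  qed
  have "Q (\<iota> u) (\<iota> v) = to_ac (q u v)" for u v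
    by (rule step) (metis QB qsym step sym)
  then show ?thesis using sym lin1 by (auto simp: sym_bilinear_def intro!: exI[of _ Q])
qed

lemma ext_form_spec:
  assumes "scalar_extension s t \<iota>" "sym_bilinear s q"
  shows "sym_bilinear t (ext_form t \<iota> q)"
    and "ext_form t \<iota> q (\<iota> u) (\<iota> v) = to_ac (q u v)"
  using someI_ex[OF ext_form_exists[OF assms]] unfolding ext_form_def by blast+

lemma ext_form_unique:
  fixes t :: "'k::field alg_closure \<Rightarrow> 'w::ab_group_add \<Rightarrow> 'w"
  assumes ext: "scalar_extension s t \<iota>" and q: "sym_bilinear s q"
    and Q: "sym_bilinear t Q" "\<And>u v. Q (\<iota> u) (\<iota> v) = to_ac (q u v)"
    and x: "x \<in> ext_subspace t \<iota> UNIV" and y: "y \<in> ext_subspace t \<iota> UNIV"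
  shows "Q x y = ext_form t \<iota> q x y"
proof -
  interpret p: vector_space_pair t "(*) :: 'k alg_closure \<Rightarrow> _"
    using ext by (auto simp: scalar_extension_def vector_space_pair_def vector_space_def algebra_simps)
  let ?F = "ext_form t \<iota> q"
  note F = ext_form_spec[OF ext q]
  have lin: "Vector_Spaces.linear t (*) (\<lambda>u. Q u v)" "Vector_Spaces.linear t (*) (\<lambda>u. ?F u v)" for v
    using Q(1) F(1) by (auto simp: sym_bilinear_def)
  have sym: "Q u v = Q v u" "?F u v = ?F v u" for u v
    using Q(1) F(1) unfolding sym_bilinear_def by blast+
  have *: "Q x (\<iota> v) = ?F x (\<iota> v)" if "x \<in> p.vs1.span (range \<iota>)" for x v
    by (rule p.linear_eq_on[OF lin that]) (auto simp: Q F)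
  have "Q x y = ?F x y"
    by (rule p.linear_eq_on[OF lin, where B = "range \<iota>"])
      (use x y * sym in \<open>auto simp: ext_subspace_def\<close>)
  then show ?thesis .
qed

end

theory Submission
  imports Defs
begin

text \<open>
  Choose a vector \<open>m\<close> spanning \<open>M\<close> and a direction vector \<open>d\<close> of the line, spanning its point at
  infinity.  On the plane \<open>E\<close> spanned by \<open>m\<close> and \<open>d\<close> a symmetric bilinear form \<open>q\<close> is given by three
  scalars, and the points \<open>m + x d\<close> of the line on the quadric are the roots of
  \<open>q m m + 2 x (q m d) + x\<^sup>2 (q d d)\<close>.  The root set of this polynomial in the algebraic closure is a
  pair \<open>{x, - x}\<close> with \<open>x \<noteq> 0\<close> exactly if \<open>q m d = 0\<close> and both \<open>q m m\<close> and \<open>q d d\<close> are non-zero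
  (\<open>meets_in_symmetric_pair_iff\<close>, \<open>ex_symmetric_pair_iff\<close>).  The two degenerate cases of a non-zero
  diagonal form are tangency at \<open>M\<close> (\<open>q m m = 0\<close>) and an asymptote (\<open>q d d = 0\<close>); see
  \<open>tangent_at_span_iff\<close>.  Hence the conclusion about \<open>q\<close> says precisely that the restriction of \<open>q\<close> to
  \<open>E\<close> is non-zero and diagonal with respect to \<open>m\<close> and \<open>d\<close>.

  Diagonality, that is \<open>q m d = 0\<close>, is a linear condition, so it passes from two distinct
  quadrics of the pencil to all of them.  That no member vanishes on \<open>E\<close> means that two members have linearly independent restrictions.  A
  form tangent at \<open>M\<close> is independent of one with a symmetric pair, since only the first vanishes at
  \<open>m\<close>.  Two forms with symmetric pairs \<open>\<plusminus>x\<close> and \<open>\<plusminus>x'\<close> satisfy \<open>x\<^sup>2 = - q m m / q d d\<close>, and so are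
  proportional on \<open>E\<close> only if the pairs coincide (\<open>symmetric_pair_unique\<close>).
\<close>

section \<open>Forms on a line in a vector space\<close>

lemma two_by_two_kernel_trivial:
  fixes a b :: "'k::field"
  assumes "a * r + b * s = 0" "a * r' + b * s' = 0" "r * s' \<noteq> r' * s"
  shows "a = 0 \<and> b = 0"
proof -
  have "a * (r * s' - r' * s) = s' * (a * r + b * s) - s * (a * r' + b * s')"
    and "b * (r * s' - r' * s) = r * (a * r' + b * s') - r' * (a * r + b * s)"
    by (simp_all add: algebra_simps)
  then have "a * (r * s' - r' * s) = 0" "b * (r * s' - r' * s) = 0"
    using assms(1,2) by simp_all
  then show ?thesis using assms(3) by simp
qed

context vector_space
begin

lemma span_singleton_eqI: "c \<noteq> 0 \<Longrightarrow> span {scale c v} = span {v}"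
  using span_image_scale[of "{v}" "\<lambda>_. c"] by simp

lemma in_span_pair_iff: "x \<in> span {u, v} \<longleftrightarrow> (\<exists>a b. x = scale a u + scale b v)"
  by (auto simp: span_breakdown_eq[of x u] span_singleton diff_eq_eq image_iff add.commute)

lemma span_singleton_in_proj_space_iff:
  assumes "subspace U" "u \<noteq> 0"
  shows "span {u} \<in> proj_space scale U \<longleftrightarrow> u \<in> U"
proof
  assume "span {u} \<in> proj_space scale U"
  then obtain v where v: "span {u} = span {v}" "v \<in> U" by (auto simp: proj_space_def)
  then have "span {v} \<subseteq> U" using assms by (simp add: span_minimal)
  then show "u \<in> U" using v span_base[of u "{u}"] by blast
qed (use assms in \<open>auto simp: proj_space_def\<close>)

lemma sym_bilinear_combination:
  assumes "sym_bilinear scale q"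
  shows "q (scale a u + scale b v) (scale a' u + scale b' v) =
    a * a' * q u u + (a * b' + b * a') * q u v + b * b' * q v v"
proof -
  have "Vector_Spaces.linear scale (*) (\<lambda>u. q u v)" and sym: "q u v = q v u" for u v
    using assms unfolding sym_bilinear_def by blast+
  then have l: "q (x + y) z = q x z + q y z" "q (scale c x) z = c * q x z" for x y z c
    by (auto simp: Vector_Spaces.linear_iff)
  have r: "q z (x + y) = q z x + q z y" "q z (scale c x) = c * q z x" for x y z c
    using sym l by metis+
  show ?thesis using sym[of v u] by (simp add: l r algebra_simps)
qed

lemma span_singleton_in_quadric_iff:
  assumes "sym_bilinear scale q" "u \<noteq> 0"
  shows "span {u} \<in> quadric scale q \<longleftrightarrow> q u u = 0"
proof
  assume "span {u} \<in> quadric scale q"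
  then obtain v where v: "span {u} = span {v}" "q v v = 0" by (auto simp: quadric_def)
  then obtain c where "u = scale c v"
    using span_base[of u "{u}"] by (auto simp: span_singleton)
  then show "q u u = 0"
    using sym_bilinear_combination[OF assms(1), of c v 0 0 c 0] v(2) by simp
qed (use assms in \<open>auto simp: quadric_def\<close>)

text \<open>Stated for an arbitrary basis of the plane, so that exchanging the two basis vectors turns
  the description of tangency at \<open>M\<close> into that of an asymptote.\<close>

lemma tangent_at_span_iff:
  assumes q: "sym_bilinear scale q"
    and indep: "\<And>a b. scale a u + scale b v = 0 \<Longrightarrow> a = 0 \<and> b = 0"
  shows "tangent_at scale (span {u, v}) (span {u}) q \<longleftrightarrow>
    q u u = 0 \<and> q u v = 0 \<and> q v v \<noteq> 0"
proof
  note comb = sym_bilinear_combination[OF q]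
  have vu: "q v u = q u v" using q unfolding sym_bilinear_def by blast
  have gens: "u \<in> span {u, v}" "v \<in> span {u, v}" by (simp_all add: span_base)
  {
    assume T: "tangent_at scale (span {u, v}) (span {u}) q"
    then have rad: "radical_on (span {u, v}) q = span {u}" by (simp add: tangent_at_def)
    then have "u \<in> radical_on (span {u, v}) q" by (simp add: span_base)
    then have z: "q u u = 0" "q u v = 0" using gens by (auto simp: radical_on_def)
    moreover have "q v v \<noteq> 0"
    proof
      assume "q v v = 0"
      then have "q x y = 0" if "x \<in> span {u, v}" "y \<in> span {u, v}" for x y
        using that z by (auto simp: in_span_pair_iff comb)
      then show False using T by (auto simp: tangent_at_def)
    qed
    ultimately show "q u u = 0 \<and> q u v = 0 \<and> q v v \<noteq> 0" by blast
  }
  assume z: "q u u = 0 \<and> q u v = 0 \<and> q v v \<noteq> 0"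
  have "u \<noteq> 0" using indep[of 1 0] by auto
  then have "span {u} \<in> proj_space scale (span {u, v})"
    using gens by (auto simp: proj_space_def)
  moreover have "radical_on (span {u, v}) q = span {u}"
  proof (intro equalityI subsetI)
    fix x assume x: "x \<in> radical_on (span {u, v}) q"
    then obtain a b where ab: "x = scale a u + scale b v"
      by (auto simp: radical_on_def in_span_pair_iff)
    have "q x v = 0" using x gens by (auto simp: radical_on_def)
    then have "b = 0" using comb[of a u b v 0 1] z by (simp add: ab)
    then show "x \<in> span {u}" by (auto simp: ab span_singleton)
  next
    fix x assume "x \<in> span {u}"
    then obtain a where x: "x = scale a u" by (auto simp: span_singleton)
    have "q x y = 0" if "y \<in> span {u, v}" for y
      using that comb[of a u 0 v] z by (auto simp: in_span_pair_iff x)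
    moreover have "x \<in> span {u, v}" using gens by (simp add: x span_scale)
    ultimately show "x \<in> radical_on (span {u, v}) q" by (simp add: radical_on_def)
  qed
  ultimately show "tangent_at scale (span {u, v}) (span {u}) q"
    using z gens by (auto simp: tangent_at_def)
qed

end

section \<open>Affine coordinates on the line\<close>

text \<open>The line through the affine point spanned by \<open>m\<close> whose point at infinity is spanned by \<open>d\<close>.
  The subspace \<open>H\<close> may be smaller than a hyperplane, which covers the subspace generated by \<open>H\<close>
  in a scalar extension that is larger than the tensor product.\<close>

locale coordinatized_line = vector_space s
  for s :: "'k::field \<Rightarrow> 'v::ab_group_add \<Rightarrow> 'v" +
  fixes H :: "'v set" and m d :: 'v
  assumes subspace_infinity: "subspace H"
    and origin_finite: "m \<notin> H"
    and direction_infinite: "d \<in> H"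
    and direction_nonzero: "d \<noteq> 0"
begin

lemma combination_at_infinity_iff: "s a m + s b d \<in> H \<longleftrightarrow> a = 0"
proof
  assume "s a m + s b d \<in> H"
  then have "s a m \<in> H"
    using subspace_diff[OF subspace_infinity _ subspace_scale[OF subspace_infinity direction_infinite]]
    by (metis add_diff_cancel_right')
  then have "s (inverse a) (s a m) \<in> H" by (rule subspace_scale[OF subspace_infinity])
  then show "a = 0" using origin_finite by (cases "a = 0") auto
qed (use direction_infinite subspace_infinity in \<open>simp add: subspace_scale\<close>)

lemma combination_eq_0_iff: "s a m + s b d = 0 \<longleftrightarrow> a = 0 \<and> b = 0"
proof
  assume "s a m + s b d = 0"
  moreover from this have "a = 0"
    using combination_at_infinity_iff[of a b] subspace_0[OF subspace_infinity] by simp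
  ultimately show "a = 0 \<and> b = 0" using direction_nonzero by simp
qed simp

lemma combination_eq_iff: "s a m + s b d = s a' m + s b' d \<longleftrightarrow> a = a' \<and> b = b'"
  using combination_eq_0_iff[of "a - a'" "b - b'"]
  by (auto simp: scale_left_diff_distrib algebra_simps)

lemma line_meets_infinity: "span {m, d} \<inter> H = span {d}"
proof (intro equalityI subsetI)
  fix x assume "x \<in> span {m, d} \<inter> H"
  then show "x \<in> span {d}"
    by (auto simp: in_span_pair_iff combination_at_infinity_iff span_singleton)
next
  fix x assume "x \<in> span {d}"
  then obtain b where "x = s 0 m + s b d" by (auto simp: span_singleton)
  then show "x \<in> span {m, d} \<inter> H"
    using in_span_pair_iff combination_at_infinity_iff by blast
qed

lemma affine_vector_nonzero: "m + s x d \<noteq> 0"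
  using combination_eq_0_iff[of 1 x] by simp

lemma coord_point_inject: "coord_point s m d x = coord_point s m d y \<longleftrightarrow> x = y"
proof
  assume "coord_point s m d x = coord_point s m d y"
  then have "m + s x d \<in> span {m + s y d}"
    unfolding coord_point_def using span_base[of "m + s x d" "{m + s x d}"] by simp
  then obtain c where "s 1 m + s x d = s c m + s (c * y) d"
    by (auto simp: span_singleton scale_right_distrib)
  then show "x = y" unfolding combination_eq_iff by auto
qed simp

lemma coord_point_not_infinite: "coord_point s m d x \<noteq> span {d}"
proof
  assume "coord_point s m d x = span {d}"
  then have "s 1 m + s x d \<in> span {d}"
    using span_base[of "m + s x d" "{m + s x d}"] by (simp add: coord_point_def)
  then show False using line_meets_infinity combination_at_infinity_iff[of 1 x] by auto
qed

lemma tangent_at_origin_iff: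
  assumes "sym_bilinear s q"
  shows "tangent_at s (span {m, d}) (span {m}) q \<longleftrightarrow> q m m = 0 \<and> q m d = 0 \<and> q d d \<noteq> 0"
  by (rule tangent_at_span_iff[OF assms]) (simp add: combination_eq_0_iff)

lemma asymptote_iff:
  assumes "sym_bilinear s q"
  shows "asymptote s H (span {m, d}) q \<longleftrightarrow> q d d = 0 \<and> q m d = 0 \<and> q m m \<noteq> 0"
proof -
  have "a = 0 \<and> b = 0" if "s a d + s b m = 0" for a b
    using that combination_eq_0_iff[of b a] by (simp add: add.commute)
  moreover have "q d m = q m d" using assms unfolding sym_bilinear_def by blast
  ultimately have "tangent_at s (span {d, m}) (span {d}) q \<longleftrightarrow> q d d = 0 \<and> q m d = 0 \<and> q m m \<noteq> 0"
    using tangent_at_span_iff[OF assms, of d m] by simp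
  then show ?thesis
    unfolding asymptote_def line_meets_infinity by (simp add: insert_commute)
qed

text \<open>The definition of symmetry lets the spanning vectors \<open>m'\<close>, \<open>d'\<close> of the origin and of the point
  at infinity vary.  Rescaling them only rescales the coordinate, so the fixed vectors
  \<open>m\<close> and \<open>d\<close> suffice.\<close>

lemma symmetric_about_iff:
  "symmetric_about s H (span {m, d}) (span {m}) P Q \<longleftrightarrow>
    (\<exists>x. P = coord_point s m d x \<and> Q = coord_point s m d (- x))"
proof
  assume "symmetric_about s H (span {m, d}) (span {m}) P Q"
  then obtain m' d' x where m': "m' \<in> span {m, d} - H" "span {m} = span {m'}"
    and d': "d' \<in> span {m, d} \<inter> H"
    and P: "P = coord_point s m' d' x" and Q: "Q = coord_point s m' d' (- x)"
    unfolding symmetric_about_def by blast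
  have "m' \<in> span {m}" using m'(2) span_base[of m' "{m'}"] by simp
  then obtain a where a: "m' = s a m" by (auto simp: span_singleton)
  have "a \<noteq> 0" using m'(1) a subspace_0[OF subspace_infinity] by auto
  obtain b where b: "d' = s b d" using d' by (auto simp: line_meets_infinity span_singleton)
  have "coord_point s m' d' y = coord_point s m d (y * b / a)" for y
  proof -
    have "m' + s y d' = s a (m + s (y * b / a) d)"
      using \<open>a \<noteq> 0\<close> by (simp add: a b scale_right_distrib)
    then show ?thesis unfolding coord_point_def using span_singleton_eqI[OF \<open>a \<noteq> 0\<close>] by simp
  qed
  then show "\<exists>x. P = coord_point s m d x \<and> Q = coord_point s m d (- x)"
    using P Q by (intro exI[of _ "x * b / a"]) simp
next
  assume "\<exists>x. P = coord_point s m d x \<and> Q = coord_point s m d (- x)"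
  moreover have "m \<in> span {m, d} - H" "d \<in> span {m, d} \<inter> H"
    using origin_finite direction_infinite by (simp_all add: span_base)
  ultimately show "symmetric_about s H (span {m, d}) (span {m}) P Q"
    unfolding symmetric_about_def using direction_nonzero by blast
qed

text \<open>Subtracting the equations of the quadric at \<open>x\<close> and \<open>- x\<close> isolates \<open>4 x (q m d)\<close>, which forces
  \<open>q m d = 0\<close> since \<open>2 \<noteq> 0\<close>.  Conversely \<open>2 \<noteq> 0\<close> makes \<open>x\<close> and \<open>- x\<close> distinct.  The coefficient
  \<open>q d d\<close> cannot vanish, because then the point at infinity would be a further intersection point.\<close>

lemma meets_in_symmetric_points_iff:
  assumes two: "(2::'k) \<noteq> 0" and q: "sym_bilinear s q"
  shows "meets_in_symmetric_points s H (span {m, d}) (span {m}) q P Q \<longleftrightarrow>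
    (\<exists>x. x \<noteq> 0 \<and> P = coord_point s m d x \<and> Q = coord_point s m d (- x) \<and>
      q m d = 0 \<and> q d d \<noteq> 0 \<and> q m m = - x\<^sup>2 * q d d)"
proof -
  have val: "q (s a m + s b d) (s a m + s b d) = a\<^sup>2 * q m m + 2 * a * b * q m d + b\<^sup>2 * q d d" for a b
    by (simp add: sym_bilinear_combination[OF q] power2_eq_square algebra_simps)
  have neg: "- x \<noteq> x" if "x \<noteq> 0" for x :: 'k
    using that two by (metis add_eq_0_iff mult_2 no_zero_divisors)
  show ?thesis
  proof
    assume L: "meets_in_symmetric_points s H (span {m, d}) (span {m}) q P Q"
    then obtain x where PQ: "P = coord_point s m d x" "Q = coord_point s m d (- x)"
      and "P \<noteq> Q" and I: "proj_space s (span {m, d}) \<inter> quadric s q = {P, Q}"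
      unfolding meets_in_symmetric_points_def symmetric_about_iff by blast
    then have "x \<noteq> 0" by auto
    have root: "q m m + 2 * y * q m d + y\<^sup>2 * q d d = 0"
      if "coord_point s m d y \<in> {P, Q}" for y
    proof -
      have "coord_point s m d y \<in> quadric s q" using that I by blast
      then have "q (m + s y d) (m + s y d) = 0"
        unfolding coord_point_def
        using span_singleton_in_quadric_iff[OF q affine_vector_nonzero] by simp
      then show ?thesis using val[of 1 y] by simp
    qed
    have plus: "q m m + 2 * x * q m d + x\<^sup>2 * q d d = 0" using root[of x] PQ by simp
    have minus: "q m m - 2 * x * q m d + x\<^sup>2 * q d d = 0" using root[of "- x"] PQ by simp
    have "2 * (2 * (x * q m d)) =
        (q m m + 2 * x * q m d + x\<^sup>2 * q d d) - (q m m - 2 * x * q m d + x\<^sup>2 * q d d)"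
      by (simp add: algebra_simps)
    then have "2 * (2 * (x * q m d)) = 0" by (simp only: plus minus diff_self)
    then have b: "q m d = 0" using two \<open>x \<noteq> 0\<close> by (metis mult_eq_0_iff)
    then have a: "q m m = - x\<^sup>2 * q d d" using plus by (simp add: eq_neg_iff_add_eq_0)
    have "q d d \<noteq> 0"
    proof
      assume "q d d = 0"
      then have "span {d} \<in> quadric s q" using span_singleton_in_quadric_iff[OF q direction_nonzero] by simp
      moreover have "span {d} \<in> proj_space s (span {m, d})"
        using direction_nonzero span_base[of d "{m, d}"] by (auto simp: proj_space_def)
      ultimately have "span {d} \<in> {P, Q}" using I by blast
      then show False
        using coord_point_not_infinite[of x] coord_point_not_infinite[of "- x"] by (auto simp: PQ)
    qed
    with PQ \<open>x \<noteq> 0\<close> a b show "\<exists>x. x \<noteq> 0 \<and> P = coord_point s m d x \<and> Q = coord_point s m d (- x) \<and>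
      q m d = 0 \<and> q d d \<noteq> 0 \<and> q m m = - x\<^sup>2 * q d d" by blast
  next
    assume "\<exists>x. x \<noteq> 0 \<and> P = coord_point s m d x \<and> Q = coord_point s m d (- x) \<and>
      q m d = 0 \<and> q d d \<noteq> 0 \<and> q m m = - x\<^sup>2 * q d d"
    then obtain x where x: "x \<noteq> 0" and PQ: "P = coord_point s m d x" "Q = coord_point s m d (- x)"
      and b: "q m d = 0" and c: "q d d \<noteq> 0" and a: "q m m = - x\<^sup>2 * q d d" by blast
    have on: "coord_point s m d y \<in> proj_space s (span {m, d}) \<inter> quadric s q" if "y\<^sup>2 = x\<^sup>2" for y
    proof -
      have "q (m + s y d) (m + s y d) = 0" using val[of 1 y] a b that by simp
      moreover have "m + s y d \<in> span {m, d}" by (simp add: span_add span_scale span_base)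
      ultimately show ?thesis
        unfolding coord_point_def
        using span_singleton_in_quadric_iff[OF q affine_vector_nonzero] affine_vector_nonzero
        by (auto simp: proj_space_def)
    qed
    have only: "T \<in> {P, Q}" if T: "T \<in> proj_space s (span {m, d})" "T \<in> quadric s q" for T
    proof -
      obtain v where v: "T = span {v}" "v \<in> span {m, d}" "v \<noteq> 0"
        using T(1) unfolding proj_space_def by blast
      then obtain e f where ef: "v = s e m + s f d" by (auto simp: in_span_pair_iff)
      have "q v v = 0" using T(2) v span_singleton_in_quadric_iff[OF q] by blast
      then have "q d d * (f\<^sup>2 - (e * x)\<^sup>2) = 0"
        unfolding ef val a b by (simp add: algebra_simps power_mult_distrib)
      then have "f\<^sup>2 = (e * x)\<^sup>2" using c by simp
      then have f: "f = e * x \<or> f = e * (- x)" by (auto simp: power2_eq_iff)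
      then have "e \<noteq> 0" using v(3) ef by auto
      have "span {s e m + s (e * y) d} = coord_point s m d y" for y
        using span_singleton_eqI[OF \<open>e \<noteq> 0\<close>, of "m + s y d"]
        by (simp add: coord_point_def scale_right_distrib)
      then show "T \<in> {P, Q}" using f unfolding v(1) ef PQ by blast
    qed
    have "proj_space s (span {m, d}) \<inter> quadric s q = {P, Q}"
      using on[of x] on[of "- x"] only PQ by auto
    moreover have "P \<noteq> Q" using x neg[of x] by (simp add: PQ coord_point_inject)
    moreover have "symmetric_about s H (span {m, d}) (span {m}) P Q"
      using PQ symmetric_about_iff by blast
    ultimately show "meets_in_symmetric_points s H (span {m, d}) (span {m}) q P Q"
      by (simp add: meets_in_symmetric_points_def)
  qed
qed

end

text \<open>A hyperplane meets every plane not contained in it in a line through the origin, and this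
  supplies the direction vector.\<close>

lemma affine_line_coordinates:
  fixes s :: "'k::field \<Rightarrow> 'v::ab_group_add \<Rightarrow> 'v"
  assumes V: "vector_space s" and H: "hyperplane s H" and l: "is_affine_line s H E"
    and M: "M \<in> affine_part s H E"
  obtains m d where "coordinatized_line s H m d" "M = module.span s {m}" "E = module.span s {m, d}"
proof -
  interpret vector_space s by (rule V)
  have sH: "subspace H" using H by (simp add: hyperplane_def)
  have sE: "subspace E" and dE: "dim E = 2" using l by (simp_all add: is_affine_line_def)
  obtain m where m: "M = span {m}" "m \<in> E" "m \<noteq> 0"
    using M by (auto simp: affine_part_def proj_space_def)
  have mH: "m \<notin> H"
    using M m span_singleton_in_proj_space_iff[OF sH m(3)] by (simp add: affine_part_def)
  obtain B where B: "B \<subseteq> E" "independent B" "E \<subseteq> span B" "card B = 2"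
    using basis_exists[of E] dE by metis
  have fB: "finite B" using B(4) by (simp add: card_ge_0_finite)
  have "\<not> E \<subseteq> span {m}"
  proof
    assume "E \<subseteq> span {m}"
    then have "dim E \<le> card {m}" by (intro dim_le_card) auto
    then show False using dE by simp
  qed
  then obtain e where e: "e \<in> E" "e \<notin> span {m}" by blast
  obtain w where w: "span (insert w H) = UNIV" using H by (auto simp: hyperplane_def)
  then have dec: "\<exists>k. x - s k w \<in> H" for x
    using span_breakdown_eq[of x w H] iffD2[OF span_eq_iff sH] by simp
  obtain a where a: "m - s a w \<in> H" using dec by blast
  obtain b where b: "e - s b w \<in> H" using dec by blast
  have "a \<noteq> 0" using a mH by auto
  \<comment> \<open>Subtracting the multiple of \<open>m\<close> with the same component along \<open>w\<close> moves \<open>e\<close> into \<open>H\<close>.\<close>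
  define d where "d = e - s (b / a) m"
  have "d = (e - s b w) - s (b / a) (m - s a w)"
    using \<open>a \<noteq> 0\<close> by (simp add: d_def scale_right_diff_distrib)
  then have "d \<in> H" using a b sH by (simp add: subspace_diff subspace_scale)
  have d_span: "d \<notin> span {m}"
  proof
    assume "d \<in> span {m}"
    then have "d + s (b / a) m \<in> span {m}" by (intro span_add span_scale) (auto simp: span_base)
    then show False using e by (simp add: d_def)
  qed
  then have "d \<noteq> 0" using span_zero by auto
  have "d \<in> E" unfolding d_def using e m sE by (simp add: subspace_diff subspace_scale)
  have ind: "independent {d, m}" using d_span m(3) by (simp add: independent_insertI)
  have "E \<subseteq> span {m, d}"
  proof
    fix x assume x: "x \<in> E"
    show "x \<in> span {m, d}"
    proof (rule ccontr)
      assume nx: "x \<notin> span {m, d}"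
      then have "x \<notin> span {d, m}" by (simp add: insert_commute)
      then have "independent {x, d, m}" using ind by (rule independent_insertI)
      moreover have "{x, d, m} \<subseteq> span B" using x \<open>d \<in> E\<close> m(2) B(3) by blast
      ultimately have "card {x, d, m} \<le> 2" using independent_span_bound[OF fB] B(4) by auto
      moreover have "x \<noteq> d" "x \<noteq> m" "d \<noteq> m" using nx d_span by (auto simp: span_base)
      ultimately show False by simp
    qed
  qed
  moreover have "span {m, d} \<subseteq> E" using m(2) \<open>d \<in> E\<close> sE by (simp add: span_minimal)
  moreover have "coordinatized_line s H m d"
    by unfold_locales (use sH mH \<open>d \<in> H\<close> \<open>d \<noteq> 0\<close> in auto)
  ultimately show thesis using that m(1) by blast
qed

section \<open>Passing to the algebraic closure\<close>

locale extended_line = coordinatized_line s H m d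
  for s :: "'k::field \<Rightarrow> 'v::ab_group_add \<Rightarrow> 'v" and H m d +
  fixes t :: "'k alg_closure \<Rightarrow> 'w::ab_group_add \<Rightarrow> 'w" and \<iota> :: "'v \<Rightarrow> 'w"
  assumes scalar_ext: "scalar_extension s t \<iota>"
    and char_not_two: "CHAR('k) \<noteq> 2"
begin

sublocale ext: vector_space t
  using scalar_ext by (simp add: scalar_extension_def)

lemma ext_add: "\<iota> (u + v) = \<iota> u + \<iota> v" and ext_scale: "\<iota> (s c v) = t (to_ac c) (\<iota> v)"
  using scalar_ext by (auto simp: scalar_extension_def)

lemma ext_subspace_span: "ext_subspace t \<iota> (span A) = ext.span (\<iota> ` A)"
proof -
  have "\<iota> x \<in> ext.span (\<iota> ` A)" if "x \<in> span A" for x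
    using that
  proof (induction rule: span_induct_alt)
    case base
    have "\<iota> 0 = 0" using ext_add[of 0 0] by simp
    then show ?case by (simp add: ext.span_zero)
  next
    case (step c x y)
    then show ?case
      by (simp add: ext_add ext_scale ext.span_add ext.span_scale ext.span_base)
  qed
  then have "ext.span (\<iota> ` span A) \<subseteq> ext.span (\<iota> ` A)"
    by (intro ext.span_minimal) auto
  moreover have "ext.span (\<iota> ` A) \<subseteq> ext.span (\<iota> ` span A)"
    by (intro ext.span_mono image_mono) (auto simp: span_base)
  ultimately show ?thesis by (simp add: ext_subspace_def)
qed

lemma ext_subspace_coord_point:
  "ext_subspace t \<iota> (coord_point s m d x) = coord_point t (\<iota> m) (\<iota> d) (to_ac x)"
  by (simp add: coord_point_def ext_subspace_span ext_add ext_scale)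

text \<open>The extended line again has coordinates: extending a basis of \<open>H\<close> by \<open>m\<close> keeps it
  independent, and independence survives the extension of scalars, so \<open>m\<close> stays outside the
  hyperplane.\<close>

sublocale ext: coordinatized_line t "ext_subspace t \<iota> H" "\<iota> m" "\<iota> d"
proof
  show "ext.subspace (ext_subspace t \<iota> H)" by (simp add: ext_subspace_def)
  show "\<iota> d \<in> ext_subspace t \<iota> H"
    using direction_infinite by (simp add: ext_subspace_def ext.span_base)
  have ind: "inj_on \<iota> B \<and> ext.independent (\<iota> ` B)" if "independent B" for B
    using scalar_ext that by (auto simp: scalar_extension_def)
  have "independent {d}" using direction_nonzero by simp
  then show "\<iota> d \<noteq> 0" using ind[of "{d}"] by auto
  obtain B where B: "B \<subseteq> H" "independent B" "H \<subseteq> span B"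
    using maximal_independent_subset[of H] by blast
  have spanB: "span B = H" using B subspace_infinity span_minimal by blast
  then have mB: "m \<notin> span B" using origin_finite by simp
  then have *: "inj_on \<iota> (insert m B) \<and> ext.independent (insert (\<iota> m) (\<iota> ` B))"
    using ind[of "insert m B"] independent_insertI[OF mB B(2)] by simp
  have "\<iota> m \<notin> \<iota> ` B"
    using * mB span_base[of m B] by (auto simp: inj_on_def)
  then have "\<iota> m \<notin> ext.span (\<iota> ` B)" using * by (simp add: ext.independent_insert)
  then show "\<iota> m \<notin> ext_subspace t \<iota> H"
    using ext_subspace_span[of B] by (simp add: spanB)
qed

lemma two_nonzero: "(2::'k) \<noteq> 0" "(2::'k alg_closure) \<noteq> 0"
proof -
  show 2: "(2::'k) \<noteq> 0"
  proof
    assume "(2::'k) = 0"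
    then have "CHAR('k) dvd 2" using of_nat_eq_0_iff_char_dvd[of 2, where 'a = 'k] by simp
    then have "CHAR('k) = 1 \<or> CHAR('k) = 2" using prime_nat_iff two_is_prime_nat by blast
    then show False using char_not_two CHAR_not_1' by simp
  qed
  show "(2::'k alg_closure) \<noteq> 0" using 2 to_ac_eq_0_iff[of "2::'k"] by simp
qed

text \<open>An intersection over \<open>K\<close> is also one over \<open>L\<close>, so that both alternatives in the definition of a
  symmetric pair reduce to a root in \<open>L\<close>.\<close>

lemma meets_in_symmetric_pair_iff:
  assumes q: "sym_bilinear s q"
  shows "meets_in_symmetric_pair s t \<iota> H (span {m, d}) (span {m}) q Z \<longleftrightarrow>
    q m d = 0 \<and> q d d \<noteq> 0 \<and>
    (\<exists>x. x \<noteq> 0 \<and> to_ac (q m m) = - x\<^sup>2 * to_ac (q d d) \<and>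
      Z = {coord_point t (\<iota> m) (\<iota> d) x, coord_point t (\<iota> m) (\<iota> d) (- x)})"
proof -
  note F = ext_form_spec[OF scalar_ext q]
  have 1: "(\<exists>P Q. meets_in_symmetric_points s H (span {m, d}) (span {m}) q P Q \<and>
            Z = {ext_subspace t \<iota> P, ext_subspace t \<iota> Q}) \<longleftrightarrow>
     (\<exists>x. x \<noteq> 0 \<and> q m d = 0 \<and> q d d \<noteq> 0 \<and> q m m = - x\<^sup>2 * q d d \<and>
       Z = {coord_point t (\<iota> m) (\<iota> d) (to_ac x), coord_point t (\<iota> m) (\<iota> d) (- to_ac x)})"
    (is "_ \<longleftrightarrow> ?overK")
    unfolding meets_in_symmetric_points_iff[OF two_nonzero(1) q]
      ext_subspace_coord_point[symmetric] to_ac_minus[symmetric] by blast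
  have 2: "(\<exists>P Q. meets_in_symmetric_points t
              (ext_subspace t \<iota> H) (ext_subspace t \<iota> (span {m, d})) (ext_subspace t \<iota> (span {m}))
              (ext_form t \<iota> q) P Q \<and> Z = {P, Q}) \<longleftrightarrow>
      q m d = 0 \<and> q d d \<noteq> 0 \<and>
      (\<exists>x. x \<noteq> 0 \<and> to_ac (q m m) = - x\<^sup>2 * to_ac (q d d) \<and>
        Z = {coord_point t (\<iota> m) (\<iota> d) x, coord_point t (\<iota> m) (\<iota> d) (- x)})"
    (is "_ \<longleftrightarrow> ?overL")
    unfolding ext_subspace_span image_insert image_empty
      ext.meets_in_symmetric_points_iff[OF two_nonzero(2) F(1)] F(2) to_ac_eq_0_iff
    by blast
  have "?overK \<Longrightarrow> ?overL"
  proof (elim exE conjE)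
    fix x assume x: "x \<noteq> 0" "q m d = 0" "q d d \<noteq> 0" "q m m = - x\<^sup>2 * q d d"
      "Z = {coord_point t (\<iota> m) (\<iota> d) (to_ac x), coord_point t (\<iota> m) (\<iota> d) (- to_ac x)}"
    then show ?overL by (intro conjI exI[of _ "to_ac x"]) simp_all
  qed
  then show ?thesis unfolding meets_in_symmetric_pair_def 1 2 by argo
qed

lemma ex_symmetric_pair_iff:
  assumes q: "sym_bilinear s q"
  shows "(\<exists>Z. meets_in_symmetric_pair s t \<iota> H (span {m, d}) (span {m}) q Z) \<longleftrightarrow>
    q m d = 0 \<and> q m m \<noteq> 0 \<and> q d d \<noteq> 0"
proof
  assume "\<exists>Z. meets_in_symmetric_pair s t \<iota> H (span {m, d}) (span {m}) q Z"
  then obtain x where b: "q m d = 0" and c: "q d d \<noteq> 0" and x: "x \<noteq> 0"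
    and a: "to_ac (q m m) = - x\<^sup>2 * to_ac (q d d)"
    unfolding meets_in_symmetric_pair_iff[OF q] by blast
  have "to_ac (q m m) \<noteq> 0" using x c by (simp add: a)
  then show "q m d = 0 \<and> q m m \<noteq> 0 \<and> q d d \<noteq> 0" using b c by simp
next
  assume z: "q m d = 0 \<and> q m m \<noteq> 0 \<and> q d d \<noteq> 0"
  obtain x where x: "x ^ 2 = - to_ac (q m m) / to_ac (q d d)"
    using nth_root_exists[of 2 "- to_ac (q m m) / to_ac (q d d)"] by auto
  have "x \<noteq> 0"
  proof
    assume "x = 0"
    then show False using x z by simp
  qed
  moreover have "to_ac (q m m) = - x\<^sup>2 * to_ac (q d d)" using z by (simp add: x)
  ultimately show "\<exists>Z. meets_in_symmetric_pair s t \<iota> H (span {m, d}) (span {m}) q Z"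
    unfolding meets_in_symmetric_pair_iff[OF q] using z by blast
qed

text \<open>The pair determines the square of the coordinate, which is the ratio of the two diagonal
  entries up to sign.\<close>

lemma symmetric_pair_unique:
  assumes F: "sym_bilinear s F" and G: "sym_bilinear s G"
    and Z: "meets_in_symmetric_pair s t \<iota> H (span {m, d}) (span {m}) F Z"
    and Z': "meets_in_symmetric_pair s t \<iota> H (span {m, d}) (span {m}) G Z'"
    and ratio: "F m m * G d d = F d d * G m m"
  shows "Z = Z'"
proof -
  obtain x where F0: "F d d \<noteq> 0" and x: "to_ac (F m m) = - x\<^sup>2 * to_ac (F d d)"
    "Z = {coord_point t (\<iota> m) (\<iota> d) x, coord_point t (\<iota> m) (\<iota> d) (- x)}"
    using Z unfolding meets_in_symmetric_pair_iff[OF F] by blast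
  obtain y where G0: "G d d \<noteq> 0" and y: "to_ac (G m m) = - y\<^sup>2 * to_ac (G d d)"
    "Z' = {coord_point t (\<iota> m) (\<iota> d) y, coord_point t (\<iota> m) (\<iota> d) (- y)}"
    using Z' unfolding meets_in_symmetric_pair_iff[OF G] by blast
  have "to_ac (F m m) * to_ac (G d d) = to_ac (F d d) * to_ac (G m m)"
    using ratio by (metis to_ac_mult)
  then have "x\<^sup>2 * (to_ac (F d d) * to_ac (G d d)) = y\<^sup>2 * (to_ac (F d d) * to_ac (G d d))"
    unfolding x(1) y(1) by (simp add: algebra_simps)
  then have "x\<^sup>2 = y\<^sup>2" using F0 G0 by simp
  then have "x = y \<or> x = - y" by (simp add: power2_eq_iff)
  then show "Z = Z'" by (auto simp: x y)
qed

lemma tangent_asymptote_or_pair_iff: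
  assumes q: "sym_bilinear s q"
  shows "(tangent_at s (span {m, d}) (span {m}) q \<or> asymptote s H (span {m, d}) q) \<or>
      (\<exists>Z. meets_in_symmetric_pair s t \<iota> H (span {m, d}) (span {m}) q Z) \<longleftrightarrow>
    q m d = 0 \<and> (q m m \<noteq> 0 \<or> q d d \<noteq> 0)"
  unfolding tangent_at_origin_iff[OF q] asymptote_iff[OF q] ex_symmetric_pair_iff[OF q] by blast

end

section \<open>Diagonal pencils\<close>

lemma sym_bilinear_pencil:
  assumes "sym_bilinear s R" "sym_bilinear s S" "q \<in> pencil R S"
  shows "sym_bilinear s q"
proof -
  obtain a b where q: "q = (\<lambda>u v. a * R u v + b * S u v)" using assms(3) by (auto simp: pencil_def)
  have sym: "R u v = R v u" "S u v = S v u" for u v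
    using assms(1,2) unfolding sym_bilinear_def by blast+
  have "Vector_Spaces.linear s (*) (\<lambda>u. R u v)" "Vector_Spaces.linear s (*) (\<lambda>u. S u v)" for v
    using assms(1,2) by (auto simp: sym_bilinear_def)
  then have "Vector_Spaces.linear s (*) (\<lambda>u. q u v)" for v
    unfolding q Vector_Spaces.linear_iff by (auto simp: algebra_simps)
  then show ?thesis unfolding sym_bilinear_def by (auto simp: q sym)
qed

text \<open>If \<open>F = a R + b S\<close> and \<open>G = a' R + b' S\<close>, the determinant of the diagonal entries of \<open>F\<close> and
  \<open>G\<close> is \<open>a b' - a' b\<close> times that of \<open>R\<close> and \<open>S\<close>.  As it is non-zero, so are both factors.  The first
  makes \<open>R m d\<close> and \<open>S m d\<close> vanish together with \<open>F m d\<close> and \<open>G m d\<close>, and the second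
  excludes a member of the pencil with both diagonal entries zero.\<close>

lemma diagonal_pencil:
  fixes R S :: "'v \<Rightarrow> 'v \<Rightarrow> 'k::field"
  assumes F: "F \<in> pencil R S" and G: "G \<in> pencil R S" and q: "q \<in> pencil R S"
    and diag: "F m d = 0" "G m d = 0" and det: "F m m * G d d \<noteq> F d d * G m m"
  shows "q m d = 0 \<and> (q m m \<noteq> 0 \<or> q d d \<noteq> 0)"
proof -
  obtain a b where Fe: "F = (\<lambda>u v. a * R u v + b * S u v)" using F by (auto simp: pencil_def)
  obtain a' b' where Ge: "G = (\<lambda>u v. a' * R u v + b' * S u v)" using G by (auto simp: pencil_def)
  obtain x y where qe: "q = (\<lambda>u v. x * R u v + y * S u v)" and xy: "(x, y) \<noteq> (0, 0)"
    using q by (auto simp: pencil_def)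
  have "F m m * G d d - F d d * G m m = (a * b' - a' * b) * (R m m * S d d - R d d * S m m)"
    by (simp add: Fe Ge algebra_simps)
  then have ab: "a * b' \<noteq> a' * b" and rs: "R m m * S d d \<noteq> R d d * S m m" using det by auto
  have "R m d = 0 \<and> S m d = 0"
    by (rule two_by_two_kernel_trivial[OF _ _ ab]) (use diag in \<open>simp_all add: Fe Ge mult.commute\<close>)
  moreover have "q m m \<noteq> 0 \<or> q d d \<noteq> 0"
    using two_by_two_kernel_trivial[OF _ _ rs, of x y] xy by (auto simp: qe)
  ultimately show ?thesis by (simp add: qe)
qed

theorem proposition4:
  fixes s :: "'k::field \<Rightarrow> 'v::ab_group_add \<Rightarrow> 'v"
    and t :: "'k alg_closure \<Rightarrow> 'w::ab_group_add \<Rightarrow> 'w"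
    and \<iota> :: "'v \<Rightarrow> 'w"
    and H E M :: "'v set"
    and R S :: "'v \<Rightarrow> 'v \<Rightarrow> 'k"
  assumes char: "CHAR('k) \<noteq> 2"
    and V: "vector_space s"
    and VL: "scalar_extension s t \<iota>"
    and H: "hyperplane s H"
    and l: "is_affine_line s H E"
    and M: "M \<in> affine_part s H E"
    and R: "sym_bilinear s R"
    and S: "sym_bilinear s S"
    and RS: "lin_indep_forms R S"
    and cond:
      "(\<exists>F\<in>pencil R S. \<exists>G\<in>pencil R S. \<not> same_quadric F G \<and>
          tangent_at s E M F \<and>
          (\<exists>Z. meets_in_symmetric_pair s t \<iota> H E M G Z)) \<or>
       (\<exists>F\<in>pencil R S. \<exists>G\<in>pencil R S. \<not> same_quadric F G \<and>
          (\<exists>Z Z'. meets_in_symmetric_pair s t \<iota> H E M F Z \<and>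
                 meets_in_symmetric_pair s t \<iota> H E M G Z' \<and> Z \<noteq> Z'))"
  shows "\<forall>q\<in>pencil R S.
      (tangent_at s E M q \<or> asymptote s H E q) \<or>
      (\<exists>Z. meets_in_symmetric_pair s t \<iota> H E M q Z)"
proof -
  obtain m d where md: "coordinatized_line s H m d"
    and Me: "M = module.span s {m}" and Ee: "E = module.span s {m, d}"
    using affine_line_coordinates[OF V H l M] .
  interpret coordinatized_line s H m d by (rule md)
  interpret extended_line s H m d t \<iota> by unfold_locales (use VL char in auto)
  note form = sym_bilinear_pencil[OF R S]
  obtain F G where FG: "F \<in> pencil R S" "G \<in> pencil R S" "F m d = 0" "G m d = 0"
    "F m m * G d d \<noteq> F d d * G m m"
    using cond
  proof (elim disjE bexE conjE)
    fix F G assume F: "F \<in> pencil R S" and G: "G \<in> pencil R S"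
      and T: "tangent_at s E M F" and "\<exists>Z. meets_in_symmetric_pair s t \<iota> H E M G Z"
    then have "G m d = 0 \<and> G m m \<noteq> 0 \<and> G d d \<noteq> 0"
      using ex_symmetric_pair_iff[OF form[OF G]] by (simp add: Me Ee)
    moreover have "F m m = 0 \<and> F m d = 0 \<and> F d d \<noteq> 0"
      using T tangent_at_origin_iff[OF form[OF F]] by (simp add: Me Ee)
    ultimately show thesis using F G by (intro that[of F G]) auto
  next
    fix F G assume F: "F \<in> pencil R S" and G: "G \<in> pencil R S"
      and "\<exists>Z Z'. meets_in_symmetric_pair s t \<iota> H E M F Z \<and>
                 meets_in_symmetric_pair s t \<iota> H E M G Z' \<and> Z \<noteq> Z'"
    then obtain Z Z' where Z: "meets_in_symmetric_pair s t \<iota> H E M F Z"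
      and Z': "meets_in_symmetric_pair s t \<iota> H E M G Z'" and "Z \<noteq> Z'" by blast
    then have "F m m * G d d \<noteq> F d d * G m m"
      using symmetric_pair_unique[OF form[OF F] form[OF G]] by (auto simp: Me Ee)
    moreover have "F m d = 0" "G m d = 0"
      using Z Z' ex_symmetric_pair_iff[OF form[OF F]] ex_symmetric_pair_iff[OF form[OF G]]
      unfolding Me Ee by blast+
    ultimately show thesis using F G that by blast
  qed
  show ?thesis
    unfolding Me Ee
    using tangent_asymptote_or_pair_iff[OF form] diagonal_pencil[OF FG(1,2) _ FG(3,4,5)] by blast
qed

end
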